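(* Let $\mu$ and $\nu$ be finite Borel measures on $\mathbb{R}^d$ with compact supports, and for $t\in\mathbb{R}^d$ let $\nu_t$ be the translation of $\nu$ by $t$. Then there is at most one $t\in\mathbb{R}^d$ such that $$\dim_{\mathrm{F}}(\mu+\nu_t)>\min(\dim_{\mathrm{F}}\mu,\ \dim_{\mathrm{F}}\nu).$$
   Context: The translation of $\nu$ by $t$ is the image of $\nu$ under $x\mapsto x+t$. For a finite Borel measure $\mu$ on $\mathbb{R}^d$, $\widehat\mu(\xi)=\int e^{-2\pi i \xi\cdot x}\,d\mu(x)$ for $\xi\in\mathbb{R}^d$. The notation $f(\xi)\lesssim g(\xi)$ means there is a constant $C$ with $|f(\xi)|\le C|g(\xi)|$ for all $\xi$ (negative powers of $|\xi|$ are read as $+\infty$ at $\xi=0$). The Fourier dimension of $\mu$ is $\dim_{\mathrm{F}}\mu=\sup\{s\in[0,d]:\ \widehat\mu(\xi)\lesssim|\xi|^{-s/2}\}$. *)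

theory Defs
  imports "HOL-Analysis.Analysis"
begin

definition measure_support :: "(real ^ 'n) measure \<Rightarrow> (real ^ 'n) set" where
  "measure_support M = {x. \<forall>U. open U \<and> x \<in> U \<longrightarrow> emeasure M U > 0}"

definition measure_add :: "'a measure \<Rightarrow> 'a measure \<Rightarrow> 'a measure" where
  "measure_add M N = measure_of (space M) (sets M) (\<lambda>A. emeasure M A + emeasure N A)"

text \<open>The value of a measure built by \<^const>\<open>measure_of\<close> is only meaningful once the
  given set function is known to be countably additive; this is the case here.\<close>

lemma emeasure_measure_add:
  assumes sets_eq: "sets M = sets N" and A: "A \<in> sets M"
  shows "emeasure (measure_add M N) A = emeasure M A + emeasure N A"
proof -
  have "countably_additive (sets M) (\<lambda>A. emeasure M A + emeasure N A)"
  proof (rule countably_additiveI)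
    fix F :: "nat \<Rightarrow> 'a set"
    assume F: "range F \<subseteq> sets M" "disjoint_family F"
    then have "range F \<subseteq> sets N" using sets_eq by simp
    then show "(\<Sum>i. emeasure M (F i) + emeasure N (F i))
        = emeasure M (\<Union> (range F)) + emeasure N (\<Union> (range F))"
      using F by (simp add: suminf_add[symmetric] suminf_emeasure)
  qed
  then show ?thesis
    unfolding measure_add_def using A
    by (intro emeasure_measure_of_sigma sets.sigma_algebra_axioms)
      (auto simp: positive_def)
qed

definition translate_measure :: "(real ^ 'n) measure \<Rightarrow> real ^ 'n \<Rightarrow> (real ^ 'n) measure" where
  "translate_measure N t = distr N borel (\<lambda>x. x + t)"

definition fourier_transform :: "(real ^ 'n) measure \<Rightarrow> real ^ 'n \<Rightarrow> complex" where
  "fourier_transform M \<xi> =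
    (\<integral>x. exp (- 2 * complex_of_real pi * \<i> * complex_of_real (\<xi> \<bullet> x)) \<partial>M)"

text \<open>The bound is imposed only for \<^term>\<open>\<xi> \<noteq> 0\<close>: a negative power of the norm is read as
  infinite at the origin, whereas \<^term>\<open>0 powr a = (0::real)\<close> in the library. For
  \<^term>\<open>s = (0::real)\<close> the origin is harmless too, since a single finite value can be absorbed
  in the constant.\<close>

definition fourier_decay :: "(real ^ 'n) measure \<Rightarrow> real \<Rightarrow> bool" where
  "fourier_decay M s \<longleftrightarrow>
    (\<exists>C. \<forall>\<xi>. \<xi> \<noteq> 0 \<longrightarrow> cmod (fourier_transform M \<xi>) \<le> C * norm \<xi> powr (- s / 2))"

text \<open>For a finite measure the set below contains 0, so the supremum is taken over a nonempty
  bounded set of reals.\<close>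

definition fourier_dim :: "(real ^ 'n) measure \<Rightarrow> real" where
  "fourier_dim M = Sup {s \<in> {0..real CARD('n)}. fourier_decay M s}"

end

theory Submission
  imports Defs
begin

text \<open>If \<open>t\<close> and \<open>u\<close> both enlarge the dimension, then subtracting the two transforms shows that
  \<open>1 - e(\<tau> \<bullet> \<xi>)\<close> times the transform of \<open>\<nu>\<close> decays like \<open>|\<xi>| powr (- s / 2)\<close>, where
  \<open>\<tau> = t - u\<close>, \<open>e(x) = cis (2 * pi * x)\<close> and \<open>s\<close> exceeds both dimensions. The factor is harmful
  only when \<open>\<tau> \<bullet> \<xi>\<close> lies within \<open>\<epsilon> = |\<xi>| powr (- \<alpha>)\<close> of an integer. At such a \<open>\<xi>\<close> an \<open>m\<close>-th order
  finite difference with step \<open>\<epsilon>\<close> in the direction \<open>\<tau>\<close> expresses the transform by its values at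
  harmless points, up to an error of order \<open>\<epsilon> ^ m\<close>, because \<open>\<nu>\<close> has bounded support. Taking \<open>\<alpha>\<close>
  small and \<open>m\<close> large, \<open>\<nu>\<close>, and hence \<open>\<mu>\<close>, decays with every exponent below \<open>s\<close>.\<close>

section \<open>Sums of measures and integration against them\<close>

lemma space_measure_add [simp]: "space (measure_add M N) = space M"
  by (simp add: measure_add_def space_measure_of_conv)

lemma sets_measure_add [simp, measurable_cong]: "sets (measure_add M N) = sets M"
  by (simp add: measure_add_def)

lemma finite_measure_measure_add:
  assumes "finite_measure M" "finite_measure N" "sets M = sets N"
  shows "finite_measure (measure_add M N)"
proof -
  interpret M: finite_measure M by fact
  interpret N: finite_measure N by fact
  have "emeasure (measure_add M N) (space M) = emeasure M (space M) + emeasure N (space M)"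
    by (rule emeasure_measure_add[OF assms(3)]) simp
  then show ?thesis
    by (intro finite_measureI) (simp add: M.emeasure_eq_measure N.emeasure_eq_measure)
qed

text \<open>Induction over integrable functions: indicators, sums, dominated limits. Integrability
  for each summand is part of the claim because the additivity step draws on it.\<close>

lemma integral_measure_add:
  fixes f :: "'a \<Rightarrow> 'b::{banach, second_countable_topology}"
  assumes eq: "sets M = sets N" and f: "integrable (measure_add M N) f"
  shows "integrable M f \<and> integrable N f
    \<and> integral\<^sup>L (measure_add M N) f = integral\<^sup>L M f + integral\<^sup>L N f"
  using f
proof (induction rule: integrable_induct)
  case (base A c)
  then have A: "A \<in> sets M" "A \<in> sets N" using eq by auto
  have fin: "emeasure M A < \<infinity>" "emeasure N A < \<infinity>"
    using base(2) by (auto simp: emeasure_measure_add[OF eq A(1)])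
  have "measure (measure_add M N) A = measure M A + measure N A"
    using fin by (simp add: measure_def emeasure_measure_add[OF eq A(1)] enn2real_plus)
  then show ?case
    using A fin base by (simp add: scaleR_add_left)
next
  case (add f g)
  then show ?case by (simp add: algebra_simps)
next
  case (lim f s)
  have sp: "space N = space M" using eq[symmetric] by (rule sets_eq_imp_space_eq)
  have meas: "f \<in> borel_measurable M" "f \<in> borel_measurable N"
    "\<And>i. s i \<in> borel_measurable M" "\<And>i. s i \<in> borel_measurable N"
    using lim.hyps(4)[THEN borel_measurable_integrable] lim.hyps(1)[THEN borel_measurable_integrable]
      measurable_cong_sets[OF sets_measure_add refl] measurable_cong_sets[OF eq refl] by blast+
  \<comment> \<open>Both measures lie below their sum, so a finite integral of
    \<open>norm (f x)\<close> against the sum is finite against each of them.\<close>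
  have le: "nn_integral K g \<le> nn_integral (measure_add M N) g" if "K = M \<or> K = N" for K g
    using that eq
    by (intro nn_integral_mono_measure)
      (auto simp: le_measure emeasure_measure_add[OF eq])
  have int: "integrable M f" "integrable N f"
    using lim.hyps(4) meas le[of M "\<lambda>x. norm (f x)"] le[of N "\<lambda>x. norm (f x)"]
    by (auto simp: integrable_iff_bounded)
  \<comment> \<open>The approximants supplied by the induction satisfy
    \<open>norm (s i x) \<le> 2 * norm (f x)\<close>, so one dominating function serves all three
    measures.\<close>
  have conv: "(\<lambda>i. integral\<^sup>L K (s i)) \<longlonglongrightarrow> integral\<^sup>L K f"
    if "f \<in> borel_measurable K" "\<And>i. s i \<in> borel_measurable K" "integrable K f"
       "space K = space M" for K
    using that lim.hyps(2,3)
    by (intro integral_dominated_convergence[where w = "\<lambda>x. 2 * norm (f x)"]) auto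
  have "(\<lambda>i. integral\<^sup>L (measure_add M N) (s i)) \<longlonglongrightarrow> integral\<^sup>L M f + integral\<^sup>L N f"
    using tendsto_add[OF conv conv, of M N] meas int sp lim.IH by simp
  moreover have "(\<lambda>i. integral\<^sup>L (measure_add M N) (s i)) \<longlonglongrightarrow> integral\<^sup>L (measure_add M N) f"
    using lim.hyps(1,4) by (intro conv) auto
  ultimately show ?case
    using int LIMSEQ_unique by blast
qed

section \<open>Fourier transforms of sums and translates\<close>

lemma fourier_transform_cis:
  "fourier_transform M \<xi> = (\<integral>x. cis (- (2 * pi * (\<xi> \<bullet> x))) \<partial>M)"
  unfolding fourier_transform_def cis_conv_exp
  by (intro Bochner_Integration.integral_cong refl arg_cong[where f = exp]) simp

lemma measurable_cis_inner [measurable]: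
  assumes [measurable_cong]: "sets M = sets borel"
  shows "(\<lambda>x. cis (- (2 * pi * (\<xi> \<bullet> (x :: real ^ 'n))))) \<in> borel_measurable M"
proof -
  have "(\<lambda>x. cis (- (2 * pi * (\<xi> \<bullet> (x :: real ^ 'n))))) \<in> borel_measurable borel"
    by (intro borel_measurable_continuous_onI continuous_intros)
  then show ?thesis by measurable
qed

lemma integrable_cis_inner:
  assumes "finite_measure M" "sets M = sets borel"
  shows "integrable M (\<lambda>x. cis (- (2 * pi * (\<xi> \<bullet> (x :: real ^ 'n)))))"
  by (rule finite_measure.integrable_const_bound[OF assms(1), where B = 1])
    (simp_all add: measurable_cis_inner[OF assms(2)])

lemma norm_fourier_transform_le:
  assumes "finite_measure M"
  shows "cmod (fourier_transform M \<xi>) \<le> measure M (space M)"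
  unfolding fourier_transform_cis
  using integral_norm_bound[of M "\<lambda>x. cis (- (2 * pi * (\<xi> \<bullet> x)))"] by simp

lemma fourier_transform_measure_add:
  assumes "finite_measure M" "finite_measure N" "sets M = sets borel" "sets N = sets borel"
  shows "fourier_transform (measure_add M N) \<xi> = fourier_transform M \<xi> + fourier_transform N \<xi>"
  unfolding fourier_transform_cis using assms
  by (intro integral_measure_add[THEN conjunct2, THEN conjunct2]
      integrable_cis_inner finite_measure_measure_add) auto

lemma sets_translate_measure [simp]: "sets (translate_measure N t) = sets borel"
  by (simp add: translate_measure_def)

lemma finite_measure_translate_measure:
  assumes "finite_measure N" "sets N = sets borel"
  shows "finite_measure (translate_measure N t)"
proof -
  have [measurable_cong]: "sets N = sets borel" by fact
  show ?thesis
    unfolding translate_measure_def by (intro finite_measure.finite_measure_distr assms(1)) measurable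
qed

lemma fourier_transform_translate_measure:
  assumes "sets N = sets borel"
  shows "fourier_transform (translate_measure N t) \<xi>
    = cis (- (2 * pi * (\<xi> \<bullet> t))) * fourier_transform N \<xi>"
proof -
  have [measurable_cong]: "sets N = sets borel" by fact
  have "fourier_transform (translate_measure N t) \<xi> = (\<integral>x. cis (- (2 * pi * (\<xi> \<bullet> (x + t)))) \<partial>N)"
    unfolding fourier_transform_cis translate_measure_def
    by (intro integral_distr measurable_cis_inner refl) measurable
  also have "\<dots> = (\<integral>x. cis (- (2 * pi * (\<xi> \<bullet> t))) * cis (- (2 * pi * (\<xi> \<bullet> x))) \<partial>N)"
    by (simp add: cis_mult inner_add_right distrib_left add.commute)
  finally show ?thesis by (simp add: fourier_transform_cis)
qed

text \<open>The complement of the support is a union of open null sets. By Lindelof countably many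
  of them have the same union, which is therefore null.\<close>

lemma AE_measure_support:
  fixes M :: "(real ^ 'n) measure"
  assumes "sets M = sets borel"
  shows "AE x in M. x \<in> measure_support M"
proof -
  define F where "F = {U. open U \<and> emeasure M U = 0}"
  obtain F' where F': "F' \<subseteq> F" "countable F'" "\<Union>F' = \<Union>F"
    by (rule Lindelof[of F]) (auto simp: F_def)
  have "\<Union>F' \<in> null_sets M"
    using F' assms by (intro null_sets_UN'[of F' "\<lambda>x. x", simplified]) (auto simp: F_def null_sets_def)
  moreover have "x \<in> \<Union>F'" if "x \<notin> measure_support M" for x
    using that unfolding F'(3) by (auto simp: F_def measure_support_def)
  ultimately show ?thesis
    by (intro AE_I'[of "\<Union>F'"]) auto
qed

section \<open>Size of \<open>1 - cis x\<close> and finite differences of the transform\<close>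

lemma norm_diff_cis_le: "cmod (1 - cis x) \<le> \<bar>x\<bar>"
  using dist_exp_i_1[of x] abs_sin_x_le_abs_x[of "x/2"]
  by (simp add: cis_conv_exp norm_minus_commute)

text \<open>The modulus is \<open>2 * \<bar>sin (pi * x)\<bar>\<close>. With
  \<open>y = pi * \<bar>x\<bar> \<le> 2\<close>, Taylor gives
  \<open>sin y \<ge> y - y ^ 3 / 6 \<ge> y / 3\<close>, and \<open>pi > 3\<close> finishes.\<close>

lemma norm_diff_cis_ge:
  assumes "\<bar>x\<bar> \<le> 1/2"
  shows "2 * \<bar>x\<bar> \<le> cmod (1 - cis (2 * pi * x))"
proof -
  define y where "y = pi * \<bar>x\<bar>"
  have y: "0 \<le> y" "y \<le> 2"
    using assms pi_less_4 mult_mono[of pi 4 "\<bar>x\<bar>" "1/2"] by (auto simp: y_def)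
  have "\<bar>sin y - y\<bar> \<le> y ^ 3 / 6"
    using Maclaurin_sin_bound[of y 3] y
    by (simp add: numeral_3_eq_3 sin_coeff_def fact_numeral field_simps)
  moreover have "y ^ 3 \<le> y * 4"
    using mult_left_mono[OF power_mono[of y 2 2] y(1)] y by (simp add: power3_eq_cube power2_eq_square)
  ultimately have "y / 3 \<le> sin y" by linarith
  moreover have "3 * \<bar>x\<bar> \<le> y"
    using pi_gt3 by (auto simp: y_def intro: mult_right_mono)
  moreover have "cmod (1 - cis (2 * pi * x)) = 2 * \<bar>sin (pi * x)\<bar>"
    using dist_exp_i_1[of "2 * pi * x"] by (simp add: cis_conv_exp norm_minus_commute)
  moreover have "\<bar>sin (pi * x)\<bar> = \<bar>sin y\<bar>"
    by (cases "x \<ge> 0") (auto simp: y_def)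
  ultimately show ?thesis by linarith
qed

lemma norm_diff_cis_ge_int:
  assumes "e \<le> \<bar>x - of_int n\<bar>" "\<bar>x - of_int n\<bar> \<le> 1/2"
  shows "2 * e \<le> cmod (1 - cis (2 * pi * x))"
proof -
  have "cis (2 * pi * x) = cis (2 * pi * (x - of_int n)) * cis (2 * pi * of_int n)"
    by (simp add: cis_mult algebra_simps)
  then have "cis (2 * pi * x) = cis (2 * pi * (x - of_int n))" by simp
  then show ?thesis using norm_diff_cis_ge[OF assms(2)] assms(1) by simp
qed

text \<open>By the binomial theorem the alternating sum is the integral of a unimodular function
  times \<open>(1 - cis (- (2 * pi * (\<eta> \<bullet> x)))) ^ m\<close>. Where
  \<open>norm x \<le> R\<close>, each of the \<open>m\<close> factors is at most
  \<open>2 * pi * norm \<eta> * R\<close>.\<close>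

lemma norm_finite_difference_fourier_transform_le:
  fixes M :: "(real ^ 'n) measure"
  assumes fin: "finite_measure M" and sets: "sets M = sets borel"
    and R: "AE x in M. norm x \<le> R"
  shows "cmod (\<Sum>j\<le>m. of_nat (m choose j) * (- 1) ^ j * fourier_transform M (\<xi> + real j *\<^sub>R \<eta>))
    \<le> (2 * pi * norm \<eta> * R) ^ m * measure M (space M)"
proof -
  interpret finite_measure M by fact
  let ?g = "\<lambda>x. cis (- (2 * pi * (\<xi> \<bullet> x))) * (1 - cis (- (2 * pi * (\<eta> \<bullet> x)))) ^ m"
  have g: "?g x = (\<Sum>j\<le>m. of_nat (m choose j) * (- 1) ^ j * cis (- (2 * pi * ((\<xi> + real j *\<^sub>R \<eta>) \<bullet> x))))"
    for x
  proof -
    have "(1 - cis (- (2 * pi * (\<eta> \<bullet> x)))) ^ m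
      = (\<Sum>j\<le>m. of_nat (m choose j) * (- cis (- (2 * pi * (\<eta> \<bullet> x)))) ^ j)"
      using binomial_ring[of "- cis (- (2 * pi * (\<eta> \<bullet> x)))" 1 m] by simp
    then show ?thesis
      by (simp add: sum_distrib_left power_minus[of "cis _"] Complex.DeMoivre cis_mult inner_add_left algebra_simps)
  qed
  have "(\<Sum>j\<le>m. of_nat (m choose j) * (- 1) ^ j * fourier_transform M (\<xi> + real j *\<^sub>R \<eta>)) = (\<integral>x. ?g x \<partial>M)"
    unfolding g fourier_transform_cis
    by (subst Bochner_Integration.integral_sum)
      (auto intro!: integrable_mult_right integrable_cis_inner fin sets)
  moreover have "integrable M ?g"
    unfolding g by (auto intro!: integrable_mult_right integrable_cis_inner fin sets Bochner_Integration.integrable_sum)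
  moreover have "AE x in M. cmod (?g x) \<le> (2 * pi * norm \<eta> * R) ^ m"
    using R
  proof eventually_elim
    case (elim x)
    have "cmod (1 - cis (- (2 * pi * (\<eta> \<bullet> x)))) \<le> 2 * pi * \<bar>\<eta> \<bullet> x\<bar>"
      using norm_diff_cis_le[of "- (2 * pi * (\<eta> \<bullet> x))"] by (simp add: abs_mult)
    also have "\<dots> \<le> 2 * pi * (norm \<eta> * R)"
      using Cauchy_Schwarz_ineq2[of \<eta> x] mult_left_mono[OF elim, of "norm \<eta>"] by simp
    finally have "cmod (1 - cis (- (2 * pi * (\<eta> \<bullet> x)))) \<le> 2 * pi * norm \<eta> * R" by simp
    from power_mono[OF this, of m] show ?case by (simp add: norm_mult norm_power)
  qed
  ultimately show ?thesis
    using order_trans[OF integral_norm_bound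
        integral_mono_AE[of M "\<lambda>x. cmod (?g x)" "\<lambda>x. (2 * pi * norm \<eta> * R) ^ m"]]
    by (simp add: mult.commute)
qed

section \<open>Decay exponents\<close>

lemma fourier_decayI:
  assumes fin: "finite_measure M" and s: "0 \<le> s" and R: "0 < R"
    and bound: "\<And>\<xi>. R \<le> norm \<xi> \<Longrightarrow> cmod (fourier_transform M \<xi>) \<le> C * norm \<xi> powr (- s / 2)"
  shows "fourier_decay M s"
proof -
  let ?V = "measure M (space M)"
  \<comment> \<open>The second entry handles frequencies below \<open>R\<close>: there the transform
    is at most \<open>?V\<close>, while \<open>norm \<xi> powr (- s / 2)\<close> is at least
    \<open>R powr (- s / 2)\<close>.\<close>
  let ?D = "max C (?V * R powr (s / 2))"
  have "cmod (fourier_transform M \<xi>) \<le> ?D * norm \<xi> powr (- s / 2)" if "\<xi> \<noteq> 0" for \<xi>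
  proof (cases "R \<le> norm \<xi>")
    case True
    show ?thesis
      by (rule order_trans[OF bound[OF True]]) (simp add: mult_right_mono)
  next
    case False
    have "R powr (- s / 2) \<le> norm \<xi> powr (- s / 2)"
      using False that s by (intro powr_mono2') auto
    then have "1 \<le> R powr (s / 2) * norm \<xi> powr (- s / 2)"
      using R by (simp add: powr_minus field_simps)
    then have "?V * 1 \<le> ?V * (R powr (s / 2) * norm \<xi> powr (- s / 2))"
      by (intro mult_left_mono) auto
    then show ?thesis
      using norm_fourier_transform_le[OF fin, of \<xi>]
        mult_right_mono[of "?V * R powr (s / 2)" ?D "norm \<xi> powr (- s / 2)"]
      by (simp add: mult.assoc)
  qed
  then show ?thesis unfolding fourier_decay_def by blast
qed

lemma fourier_decay_mono:
  assumes fin: "finite_measure M" and d: "fourier_decay M s" and s: "0 \<le> s'" "s' \<le> s"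
  shows "fourier_decay M s'"
proof -
  obtain C where C: "\<And>\<xi>. \<xi> \<noteq> 0 \<Longrightarrow> cmod (fourier_transform M \<xi>) \<le> C * norm \<xi> powr (- s / 2)"
    using d unfolding fourier_decay_def by blast
  show ?thesis
  \<comment> \<open>The powers compare in the required direction once
    \<open>norm \<xi> \<ge> 1\<close>. The absolute value supplies the nonnegativity that
    \<open>mult_mono\<close> asks for.\<close>
  proof (rule fourier_decayI[OF fin s(1), of 1 "\<bar>C\<bar>"])
    fix \<xi> :: "real ^ 'a"
    assume \<xi>: "1 \<le> norm \<xi>"
    have "cmod (fourier_transform M \<xi>) \<le> C * norm \<xi> powr (- s / 2)"
      using \<xi> by (intro C) auto
    also have "\<dots> \<le> \<bar>C\<bar> * norm \<xi> powr (- s' / 2)"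
      using \<xi> s by (intro mult_mono powr_mono) auto
    finally show "cmod (fourier_transform M \<xi>) \<le> \<bar>C\<bar> * norm \<xi> powr (- s' / 2)" .
  qed auto
qed

section \<open>Removing the oscillating factor\<close>

lemma fourier_decay_of_translate_difference:
  fixes M :: "(real ^ 'n) measure"
  assumes fin: "finite_measure M" and sets: "sets M = sets borel"
    and cpt: "compact (measure_support M)" and \<tau>: "\<tau> \<noteq> 0" and s: "0 \<le> s'" "s' < s"
    and C: "\<And>\<xi>. \<xi> \<noteq> 0 \<Longrightarrow>
      cmod ((1 - cis (2 * pi * (\<tau> \<bullet> \<xi>))) * fourier_transform M \<xi>) \<le> C * norm \<xi> powr (- s / 2)"
  shows "fourier_decay M s'"
proof -
  obtain R0 where R0: "\<And>x. x \<in> measure_support M \<Longrightarrow> norm x \<le> R0"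
    using compact_imp_bounded[OF cpt] unfolding bounded_iff by blast
  have AE: "AE x in M. norm x \<le> R0"
    using AE_measure_support[OF sets] by eventually_elim (rule R0)
  \<comment> \<open>Dividing by a factor of size at least
    \<open>\<epsilon> = norm \<xi> powr (- \<alpha>)\<close> costs \<open>\<alpha>\<close> in the
    power of \<open>norm \<xi>\<close>, exactly the gap between \<open>s / 2\<close> and
    \<open>s' / 2\<close>.\<close>
  define \<alpha> where "\<alpha> = (s - s') / 2"
  have \<alpha>: "\<alpha> > 0" using s by (simp add: \<alpha>_def)
  \<comment> \<open>This makes the finite-difference error \<open>\<epsilon> ^ m\<close> at most
    \<open>norm \<xi> powr (- s' / 2)\<close> when \<open>norm \<xi> \<ge> 1\<close>.\<close>
  obtain m where m: "s' / 2 \<le> real m * \<alpha>"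
    using real_arch_simple[of "s' / 2 / \<alpha>"] \<alpha> by (auto simp: field_simps)
  \<comment> \<open>The last term makes \<open>(m + 1) * \<epsilon> \<le> 1/2\<close>, so that all \<open>m\<close> steps stay near the same integer;
    the middle one keeps their total length below \<open>norm \<xi> / 2\<close>.\<close>
  define R where "R = max 1 (max (1 / norm \<tau>) ((2 * (real m + 1)) powr (1 / \<alpha>)))"
  let ?V = "measure M (space M)"
  \<comment> \<open>\<open>?A\<close> comes from the finite-difference error; the absolute value is
    there because \<open>R0\<close> may be negative when the support is empty. \<open>?B\<close>
    serves the harmless points, whose norm may drop to half that of \<open>\<xi>\<close>, hence
    \<open>2 powr (s / 2)\<close>.\<close>
  let ?A = "\<bar>2 * pi * R0 / norm \<tau>\<bar> ^ m * ?V"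
  let ?B = "\<bar>C\<bar> * 2 powr (s / 2)"
  let ?F = "fourier_transform M"
  show ?thesis
  proof (rule fourier_decayI[OF fin s(1), of R "?A + 2 ^ m * ?B"])
    show "0 < R" by (simp add: R_def)
    fix \<xi> :: "real ^ 'n"
    assume "R \<le> norm \<xi>"
    then have \<xi>: "1 \<le> norm \<xi>" "1 / norm \<tau> \<le> norm \<xi>" "(2 * (real m + 1)) powr (1 / \<alpha>) \<le> norm \<xi>"
      by (auto simp: R_def)
    define \<epsilon> where "\<epsilon> = norm \<xi> powr (- \<alpha>)"
    \<comment> \<open>Scaled so that \<open>\<tau> \<bullet> \<eta> = \<epsilon>\<close>: each step
      advances \<open>\<tau> \<bullet> \<xi>\<close> by exactly \<open>\<epsilon>\<close>.\<close>
    define \<eta> where "\<eta> = (\<epsilon> / (norm \<tau>)\<^sup>2) *\<^sub>R \<tau>"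
    have \<epsilon>: "0 < \<epsilon>" using \<xi> by (auto simp: \<epsilon>_def)
    have "((2 * (real m + 1)) powr (1 / \<alpha>)) powr \<alpha> \<le> norm \<xi> powr \<alpha>"
      using \<xi>(3) \<alpha> by (intro powr_mono2) auto
    then have "2 * (real m + 1) \<le> norm \<xi> powr \<alpha>"
      using \<alpha> by (simp add: powr_powr)
    then have \<epsilon>m: "(real m + 1) * \<epsilon> \<le> 1/2"
      using \<xi>(1) mult_right_mono[of "2 * (real m + 1)" "norm \<xi> powr \<alpha>" \<epsilon>] \<epsilon>
      by (auto simp: \<epsilon>_def algebra_simps simp flip: powr_add)
    have \<tau>\<eta>: "\<tau> \<bullet> (\<xi> + real j *\<^sub>R \<eta>) = \<tau> \<bullet> \<xi> + real j * \<epsilon>" for j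
      using \<tau> by (simp add: \<eta>_def inner_add_right power2_norm_eq_inner)
    have n\<eta>: "norm \<eta> = \<epsilon> / norm \<tau>"
      using \<epsilon> \<tau> by (simp add: \<eta>_def power2_eq_square)
    let ?Q = "norm \<xi> powr (- s' / 2)"
    \<comment> \<open>The threshold is \<open>\<epsilon> / 2\<close> because
      \<open>norm_diff_cis_ge_int\<close> doubles it, so the factor has modulus at least
      \<open>\<epsilon>\<close>.\<close>
    have good: "cmod (?F (\<xi> + real j *\<^sub>R \<eta>)) \<le> ?B * ?Q"
      if j: "j \<le> m" and ge: "\<epsilon> / 2 \<le> \<bar>\<tau> \<bullet> \<xi> + real j * \<epsilon> - of_int n\<bar>"
        and le: "\<bar>\<tau> \<bullet> \<xi> + real j * \<epsilon> - of_int n\<bar> \<le> 1/2" for j n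
    proof -
      let ?\<zeta> = "\<xi> + real j *\<^sub>R \<eta>"
      have "real j * \<epsilon> \<le> (real m + 1) * \<epsilon>" using j \<epsilon> by (intro mult_right_mono) auto
      then have "real j * \<epsilon> \<le> 1 / 2" using \<epsilon>m by linarith
      then have "norm (real j *\<^sub>R \<eta>) \<le> (1 / 2) / norm \<tau>"
        unfolding norm_scaleR n\<eta> using divide_right_mono[of "real j * \<epsilon>" "1/2" "norm \<tau>"] by simp
      also have "\<dots> \<le> norm \<xi> / 2" using \<xi>(2) by simp
      finally have \<zeta>: "norm \<xi> / 2 \<le> norm ?\<zeta>"
        using norm_diff_ineq[of \<xi> "real j *\<^sub>R \<eta>"] by linarith
      have "\<epsilon> \<le> cmod (1 - cis (2 * pi * (\<tau> \<bullet> ?\<zeta>)))"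
        using norm_diff_cis_ge_int[OF ge le] by (simp add: \<tau>\<eta>)
      then have "\<epsilon> * cmod (?F ?\<zeta>) \<le> cmod ((1 - cis (2 * pi * (\<tau> \<bullet> ?\<zeta>))) * ?F ?\<zeta>)"
        unfolding norm_mult by (intro mult_right_mono) auto
      also have "\<dots> \<le> C * norm ?\<zeta> powr (- s / 2)"
        using \<zeta> \<xi>(1) by (intro C) auto
      also have "\<dots> \<le> \<bar>C\<bar> * (norm \<xi> / 2) powr (- s / 2)"
        using \<zeta> \<xi>(1) s by (intro mult_mono powr_mono2') auto
      also have "\<dots> = ?B * norm \<xi> powr (- s / 2)"
        using \<xi>(1) by (simp add: powr_divide powr_minus_divide)
      also have "norm \<xi> powr (- s / 2) = \<epsilon> * ?Q"
        unfolding \<epsilon>_def powr_add[symmetric] by (rule arg_cong[where f = "\<lambda>a. norm \<xi> powr a"])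
          (simp add: \<alpha>_def field_simps)
      finally have "\<epsilon> * cmod (?F ?\<zeta>) \<le> \<epsilon> * (?B * ?Q)" by (simp add: mult_ac)
      then show ?thesis using \<epsilon> by simp
    qed
    define n where "n = round (\<tau> \<bullet> \<xi>)"
    have n: "\<bar>\<tau> \<bullet> \<xi> - of_int n\<bar> \<le> 1/2"
      using of_int_round_abs_le[of "\<tau> \<bullet> \<xi>"] by (simp add: n_def abs_minus_commute)
    have AQ: "0 \<le> ?A * ?Q" by simp
    have split: "(?A + 2 ^ m * ?B) * ?Q = ?A * ?Q + 2 ^ m * (?B * ?Q)"
      by (simp only: distrib_right mult.assoc)
    have BQ: "0 \<le> ?B * ?Q" by simp
    show "cmod (?F \<xi>) \<le> (?A + 2 ^ m * ?B) * ?Q"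
    proof (cases "\<epsilon> / 2 \<le> \<bar>\<tau> \<bullet> \<xi> - of_int n\<bar>")
      case True
      then have "cmod (?F \<xi>) \<le> ?B * ?Q" using good[of 0 n] n by simp
      moreover have "1 * (?B * ?Q) \<le> 2 ^ m * (?B * ?Q)" using BQ by (intro mult_right_mono) auto
      ultimately show ?thesis using AQ unfolding split by linarith
    next
      case False
      \<comment> \<open>Starting within \<open>\<epsilon> / 2\<close> of \<open>n\<close>, after
        \<open>j \<ge> 1\<close> steps the distance to \<open>n\<close> is at least
        \<open>j * \<epsilon> - \<epsilon> / 2 \<ge> \<epsilon> / 2\<close> and at most
        \<open>m * \<epsilon> + \<epsilon> / 2 \<le> 1/2\<close>.\<close>
      have bd: "cmod (?F (\<xi> + real j *\<^sub>R \<eta>)) \<le> ?B * ?Q" if "j \<in> {1..m}" for j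
      proof (rule good[of _ n])
        have "1 * \<epsilon> \<le> real j * \<epsilon>" "real j * \<epsilon> \<le> real m * \<epsilon>"
          using that \<epsilon> by (auto intro!: mult_right_mono)
        moreover have "real m * \<epsilon> + \<epsilon> \<le> 1/2" using \<epsilon>m by (simp add: distrib_right)
        ultimately show "\<epsilon> / 2 \<le> \<bar>\<tau> \<bullet> \<xi> + real j * \<epsilon> - of_int n\<bar>"
          "\<bar>\<tau> \<bullet> \<xi> + real j * \<epsilon> - of_int n\<bar> \<le> 1/2"
          using False by linarith+
      qed (use that in auto)
      let ?c = "\<lambda>j. of_nat (m choose j) * (- 1) ^ j * ?F (\<xi> + real j *\<^sub>R \<eta>)"
      \<comment> \<open>The term \<open>j = 0\<close> is \<open>?F \<xi>\<close> with coefficient 1,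
        so it equals the full difference minus the harmless terms.\<close>
      have "{..m} = insert 0 {1..m}" by auto
      then have "(\<Sum>j\<le>m. ?c j) = ?F \<xi> + (\<Sum>j=1..m. ?c j)" by simp
      then have "cmod (?F \<xi>) \<le> cmod (\<Sum>j\<le>m. ?c j) + cmod (\<Sum>j=1..m. ?c j)"
        using norm_triangle_ineq4[of "\<Sum>j\<le>m. ?c j" "\<Sum>j=1..m. ?c j"] by simp
      also have "cmod (\<Sum>j\<le>m. ?c j) \<le> ?A * ?Q"
      proof -
        have "cmod (\<Sum>j\<le>m. ?c j) \<le> (2 * pi * norm \<eta> * R0) ^ m * ?V"
          by (rule norm_finite_difference_fourier_transform_le[OF fin sets AE])
        also have "\<dots> \<le> \<bar>2 * pi * norm \<eta> * R0\<bar> ^ m * ?V"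
          by (intro mult_right_mono) (auto simp flip: power_abs)
        also have "\<bar>2 * pi * norm \<eta> * R0\<bar> = \<bar>2 * pi * R0 / norm \<tau>\<bar> * \<epsilon>"
          using \<epsilon> by (simp add: n\<eta> abs_mult)
        also have "\<dots> ^ m * ?V = ?A * \<epsilon> ^ m" by (simp only: power_mult_distrib mult_ac)
        also have "\<epsilon> ^ m = norm \<xi> powr (- \<alpha> * real m)"
          using \<epsilon> by (simp add: \<epsilon>_def powr_powr flip: powr_realpow)
        also have "?A * \<dots> \<le> ?A * ?Q"
          using \<xi>(1) m by (intro mult_left_mono powr_mono) (auto simp: mult.commute)
        finally show ?thesis .
      qed
      also have "cmod (\<Sum>j=1..m. ?c j) \<le> (\<Sum>j=1..m. real (m choose j) * (?B * ?Q))"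
        using bd by (intro sum_norm_le) (auto simp: norm_mult norm_power mult.assoc)
      \<comment> \<open>Adding the nonnegative term \<open>j = 0\<close> completes the row of
        binomial coefficients, whose sum is \<open>2 ^ m\<close>.\<close>
      also have "\<dots> \<le> (\<Sum>j\<le>m. real (m choose j) * (?B * ?Q))"
        using BQ by (intro sum_mono2) auto
      also have "\<dots> = 2 ^ m * (?B * ?Q)"
        unfolding sum_distrib_right[symmetric] of_nat_sum[symmetric] choose_row_sum by simp
      finally show ?thesis unfolding split by simp
    qed
  qed
qed

section \<open>Fourier dimension as a supremum of exponents\<close>

lemma le_fourier_dim:
  fixes M :: "(real ^ 'n) measure"
  assumes "fourier_decay M s" "0 \<le> s" "s \<le> real CARD('n)"
  shows "s \<le> fourier_dim M"
  unfolding fourier_dim_def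
  by (rule cSup_upper) (use assms in \<open>auto intro!: bdd_aboveI[of _ "real CARD('n)"]\<close>)

lemma fourier_decay_0:
  assumes "finite_measure M"
  shows "fourier_decay M 0"
  using norm_fourier_transform_le[OF assms] unfolding fourier_decay_def
  by (intro exI[of _ "measure M (space M)"]) auto

text \<open>The supremum need not be attained, so it is the strict inequality that yields an actual
  decay exponent; the exponent 0 keeps the set nonempty.\<close>

lemma less_fourier_dimD:
  fixes M :: "(real ^ 'n) measure"
  assumes "finite_measure M" "a < fourier_dim M"
  obtains s where "a < s" "s \<le> real CARD('n)" "fourier_decay M s"
proof -
  have "0 \<in> {s \<in> {0..real CARD('n)}. fourier_decay M s}"
    using fourier_decay_0[OF assms(1)] by simp
  then obtain s where "s \<in> {s \<in> {0..real CARD('n)}. fourier_decay M s}" "a < s"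
    using assms(2) unfolding fourier_dim_def
    by (subst (asm) less_cSup_iff) (blast, auto intro!: bdd_aboveI[of _ "real CARD('n)"])
  then show thesis using that by auto
qed

section \<open>Comparing two translations that enlarge the dimension\<close>

theorem proposition13:
  fixes \<mu> \<nu> :: "(real ^ 'n) measure"
  assumes "finite_measure \<mu>" and "sets \<mu> = sets borel" and "compact (measure_support \<mu>)"
    and "finite_measure \<nu>" and "sets \<nu> = sets borel" and "compact (measure_support \<nu>)"
  shows "\<exists>\<^sub>\<le>\<^sub>1 t. fourier_dim (measure_add \<mu> (translate_measure \<nu> t))
                > min (fourier_dim \<mu>) (fourier_dim \<nu>)"
proof (rule Uniq_I, rule ccontr)
  let ?a = "min (fourier_dim \<mu>) (fourier_dim \<nu>)"
  let ?S = "\<lambda>t. measure_add \<mu> (translate_measure \<nu> t)"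
  fix t u
  assume t: "?a < fourier_dim (?S t)" and u: "?a < fourier_dim (?S u)" and "t \<noteq> u"
  have fin: "finite_measure (?S v)" for v
    using assms by (intro finite_measure_measure_add finite_measure_translate_measure) auto
  have F: "fourier_transform (?S v) \<xi>
      = fourier_transform \<mu> \<xi> + cis (- (2 * pi * (\<xi> \<bullet> v))) * fourier_transform \<nu> \<xi>" for v \<xi>
    using assms by (simp add: fourier_transform_measure_add finite_measure_translate_measure
        fourier_transform_translate_measure)
  have a0: "0 \<le> ?a"
    using assms by (auto intro!: le_fourier_dim fourier_decay_0)
  obtain s1 where s1: "?a < s1" "s1 \<le> real CARD('n)" "fourier_decay (?S t) s1"
    using less_fourier_dimD[OF fin t] .
  obtain s2 where s2: "?a < s2" "s2 \<le> real CARD('n)" "fourier_decay (?S u) s2"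
    using less_fourier_dimD[OF fin u] .
  \<comment> \<open>\<open>s\<close> is a decay exponent common to both sums. Cancelling the factor
    gives exponents strictly below \<open>s\<close>, so \<open>r\<close> is placed strictly between
    \<open>?a\<close> and \<open>s\<close>.\<close>
  define s where "s = min s1 s2"
  define r where "r = (?a + s) / 2"
  have r: "0 \<le> r" "?a < r" "r < s" "r \<le> real CARD('n)"
    using a0 s1 s2 by (auto simp: r_def s_def field_simps min_def)
  have ds: "fourier_decay (?S t) s" "fourier_decay (?S u) s"
    using r s1 s2 by (auto intro: fourier_decay_mono[OF fin] simp: s_def)
  obtain C1 where C1: "\<And>\<xi>. \<xi> \<noteq> 0 \<Longrightarrow> cmod (fourier_transform (?S t) \<xi>) \<le> C1 * norm \<xi> powr (- s / 2)"
    using ds(1) unfolding fourier_decay_def by blast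
  obtain C2 where C2: "\<And>\<xi>. \<xi> \<noteq> 0 \<Longrightarrow> cmod (fourier_transform (?S u) \<xi>) \<le> C2 * norm \<xi> powr (- s / 2)"
    using ds(2) unfolding fourier_decay_def by blast
  have \<nu>: "fourier_decay \<nu> r"
  proof (rule fourier_decay_of_translate_difference[OF assms(4,5,6) _ r(1,3), of "t - u" "C1 + C2"])
    show "t - u \<noteq> 0" using \<open>t \<noteq> u\<close> by simp
    fix \<xi> :: "real ^ 'n"
    assume "\<xi> \<noteq> 0"
    \<comment> \<open>Subtracting the two transforms removes that of \<open>\<mu>\<close>; pulling
      out the unimodular phase of \<open>t\<close> leaves the factor for
      \<open>t - u\<close>.\<close>
    have "cis (- (2 * pi * (\<xi> \<bullet> t))) * (1 - cis (2 * pi * ((t - u) \<bullet> \<xi>)))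
        = cis (- (2 * pi * (\<xi> \<bullet> t))) - cis (- (2 * pi * (\<xi> \<bullet> u)))"
      by (simp add: right_diff_distrib cis_mult inner_diff_left inner_commute algebra_simps)
    then have "cis (- (2 * pi * (\<xi> \<bullet> t))) * ((1 - cis (2 * pi * ((t - u) \<bullet> \<xi>))) * fourier_transform \<nu> \<xi>)
        = fourier_transform (?S t) \<xi> - fourier_transform (?S u) \<xi>"
      unfolding F mult.assoc[symmetric] by (simp add: left_diff_distrib)
    then have "cmod ((1 - cis (2 * pi * ((t - u) \<bullet> \<xi>))) * fourier_transform \<nu> \<xi>)
        = cmod (fourier_transform (?S t) \<xi> - fourier_transform (?S u) \<xi>)"
      by (metis norm_cis norm_mult mult_1)
    also have "\<dots> \<le> (C1 + C2) * norm \<xi> powr (- s / 2)"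
      using norm_triangle_ineq4[of "fourier_transform (?S t) \<xi>" "fourier_transform (?S u) \<xi>"]
        C1[OF \<open>\<xi> \<noteq> 0\<close>] C2[OF \<open>\<xi> \<noteq> 0\<close>] by (simp add: distrib_right)
    finally show "cmod ((1 - cis (2 * pi * ((t - u) \<bullet> \<xi>))) * fourier_transform \<nu> \<xi>)
        \<le> (C1 + C2) * norm \<xi> powr (- s / 2)" .
  qed
  have "fourier_decay (?S t) r" using ds(1) r by (auto intro: fourier_decay_mono[OF fin])
  then obtain C3 where
    C3: "\<And>\<xi>. \<xi> \<noteq> 0 \<Longrightarrow> cmod (fourier_transform (?S t) \<xi>) \<le> C3 * norm \<xi> powr (- r / 2)"
    unfolding fourier_decay_def by blast
  obtain C4 where C4: "\<And>\<xi>. \<xi> \<noteq> 0 \<Longrightarrow> cmod (fourier_transform \<nu> \<xi>) \<le> C4 * norm \<xi> powr (- r / 2)"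
    using \<nu> unfolding fourier_decay_def by blast
  \<comment> \<open>The transform of \<open>\<mu>\<close> is that of \<open>?S t\<close> minus a
    unimodular multiple of that of \<open>\<nu>\<close>, so it inherits the exponent
    \<open>r\<close>.\<close>
  have "cmod (fourier_transform \<mu> \<xi>) \<le> (C3 + C4) * norm \<xi> powr (- r / 2)" if "\<xi> \<noteq> 0" for \<xi>
    using norm_triangle_ineq4[of "fourier_transform (?S t) \<xi>"
        "cis (- (2 * pi * (\<xi> \<bullet> t))) * fourier_transform \<nu> \<xi>"] C3[OF that] C4[OF that]
    by (simp add: F norm_mult distrib_right)
  then have "fourier_decay \<mu> r" unfolding fourier_decay_def by blast
  \<comment> \<open>Both dimensions are now at least \<open>r\<close>, hence so is their minimum
    \<open>?a\<close>, against \<open>?a < r\<close>.\<close>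
  then have "r \<le> ?a" using \<nu> r by (intro min.boundedI le_fourier_dim) auto
  then show False using r(2) by linarith
qed

end
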